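(* If $n=3q$ for a positive integer $q$, then the domination number of the discrete torus $T_n$ satisfies $D_n^T\le 4$.
   Context: The discrete $n\times n$ torus is $T_n=\{0,1,\dots,n-1\}\times\{0,1,\dots,n-1\}$, and $\pi_n:\mathbb Z\times\mathbb Z\to T_n$ is $\pi_n(x_1,x_2)=(x_1 \bmod n,\ x_2\bmod n)$, where $a \bmod b$ is the smallest non-negative remainder. A line in $\mathbb Z\times\mathbb Z$ is the intersection with $\mathbb Z\times\mathbb Z$ of a straight line in the plane through at least two integer points. A line on the torus $T_n$ is the image under $\pi_n$ of a line in $\mathbb Z\times\mathbb Z$. A set of points of $T_n$ is collinear if it is contained in a line on the torus. A point $p\in T_n$ is dominated by $S\subseteq T_n$ if $p\in S$ or there exist two distinct points $x,y\in S$ such that $\{x,y,p\}$ is collinear on the torus. $S$ is a dominating set of $T_n$ if every point of $T_n$ is dominated by $S$. The domination number $D_n^T$ is the smallest size of a dominating set of $T_n$. *)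

theory Defs
  imports "HOL-Analysis.Analysis"
begin

definition torus :: "nat \<Rightarrow> (int \<times> int) set" where
  "torus n = {0..<int n} \<times> {0..<int n}"

definition torus_proj :: "nat \<Rightarrow> int \<times> int \<Rightarrow> int \<times> int" where
  "torus_proj n x = (fst x mod int n, snd x mod int n)"

definition plane_point :: "int \<times> int \<Rightarrow> real \<times> real" where
  "plane_point x = (of_int (fst x), of_int (snd x))"

definition straight_line :: "(real \<times> real) set \<Rightarrow> bool" where
  "straight_line l \<longleftrightarrow> (\<exists>u v. u \<noteq> v \<and> l = affine hull {u, v})"

definition lattice_line :: "(int \<times> int) set \<Rightarrow> bool" where
  "lattice_line L \<longleftrightarrow>
     (\<exists>l. straight_line l \<and> (\<exists>a b. a \<noteq> b \<and> plane_point a \<in> l \<and> plane_point b \<in> l) \<and>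
          L = {x. plane_point x \<in> l})"

definition torus_line :: "nat \<Rightarrow> (int \<times> int) set \<Rightarrow> bool" where
  "torus_line n M \<longleftrightarrow> (\<exists>L. lattice_line L \<and> M = torus_proj n ` L)"

definition torus_collinear :: "nat \<Rightarrow> (int \<times> int) set \<Rightarrow> bool" where
  "torus_collinear n A \<longleftrightarrow> A \<subseteq> torus n \<and> (\<exists>M. torus_line n M \<and> A \<subseteq> M)"

definition dominated :: "nat \<Rightarrow> (int \<times> int) set \<Rightarrow> int \<times> int \<Rightarrow> bool" where
  "dominated n S p \<longleftrightarrow> p \<in> S \<or> (\<exists>x\<in>S. \<exists>y\<in>S. x \<noteq> y \<and> torus_collinear n {x, y, p})"

definition dominating_set :: "nat \<Rightarrow> (int \<times> int) set \<Rightarrow> bool" where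
  "dominating_set n S \<longleftrightarrow> S \<subseteq> torus n \<and> (\<forall>p\<in>torus n. dominated n S p)"

text \<open>
  The whole torus is a finite dominating set, so the minimum below is always attained.
\<close>

definition domination_number :: "nat \<Rightarrow> nat" where
  "domination_number n = (LEAST k. \<exists>S. dominating_set n S \<and> card S = k)"

end

theory Submission
  imports Defs "HOL-Number_Theory.Cong"
begin

text \<open>
  The corners \<open>S = {0, q} \<times> {0, q}\<close> dominate. If \<open>p - x = t d\<close> with \<open>x \<in> S\<close> and \<open>d\<close> congruent to
  \<open>\<plusminus>w\<close> modulo 3, then \<open>\<plusminus>q d\<close> is congruent to \<open>q w\<close> modulo \<open>n = 3 q\<close>, so the line through \<open>x\<close> with
  direction \<open>d\<close> contains both \<open>p\<close> and \<open>x + q w\<close>. Hence only the direction modulo 3 of \<open>p - x\<close>, with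
  powers of 3 removed, matters. Seen from \<open>(0, 0)\<close>, the other corners have all directions modulo 3
  except \<open>\<plusminus>(1, -1)\<close>; if \<open>p\<close> has that direction, then comparing the powers of 3 in \<open>p\<close> and in \<open>q\<close>
  shows that \<open>(q, 0)\<close> or \<open>(0, q)\<close> sees \<open>p\<close> in the direction of another corner.
\<close>

lemma lattice_line_through:
  fixes a d :: "int \<times> int"
  assumes "d \<noteq> (0, 0)"
  obtains L where "lattice_line L" "\<And>t. (fst a + t * fst d, snd a + t * snd d) \<in> L"
proof -
  define b where "b = (fst a + fst d, snd a + snd d)"
  define l where "l = affine hull {plane_point a, plane_point b}"
  have ab: "a \<noteq> b" "plane_point a \<noteq> plane_point b"
    using assms by (auto simp: b_def plane_point_def prod_eq_iff)
  have mem: "plane_point (fst a + t * fst d, snd a + t * snd d) \<in> l" for t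
  proof -
    have "plane_point (fst a + t * fst d, snd a + t * snd d) =
        (1 - of_int t) *\<^sub>R plane_point a + of_int t *\<^sub>R plane_point b"
      by (simp add: plane_point_def b_def algebra_simps)
    then show ?thesis
      unfolding l_def affine_hull_2
      by (intro CollectI exI[of _ "1 - of_int t"] exI[of _ "of_int t"]) simp
  qed
  have "plane_point a \<in> l" "plane_point b \<in> l"
    unfolding l_def by (auto intro: hull_inc)
  then have "lattice_line {x. plane_point x \<in> l}"
    using ab unfolding lattice_line_def straight_line_def l_def by blast
  then show thesis
    using mem by (auto intro: that)
qed

text \<open>Congruences suffice because a lattice line through \<open>x\<close> need only contain
  some representatives of \<open>y\<close> and \<open>p\<close>: a point of the torus is the
  projection of every lattice point congruent to it.\<close>

lemma torus_collinearI:
  assumes "x \<in> torus n" "y \<in> torus n" "p \<in> torus n" "d \<noteq> (0, 0)"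
    and "[fst y = fst x + s * fst d] (mod int n)" "[snd y = snd x + s * snd d] (mod int n)"
    and "[fst p = fst x + t * fst d] (mod int n)" "[snd p = snd x + t * snd d] (mod int n)"
  shows "torus_collinear n {x, y, p}"
proof -
  obtain L where L: "lattice_line L" "\<And>t. (fst x + t * fst d, snd x + t * snd d) \<in> L"
    using lattice_line_through assms(4) by blast
  have proj: "z \<in> torus_proj n ` L"
    if "z \<in> torus n" "[fst z = fst x + r * fst d] (mod int n)"
      "[snd z = snd x + r * snd d] (mod int n)" for z r
  proof -
    have "z = torus_proj n (fst x + r * fst d, snd x + r * snd d)"
      using that by (auto simp: torus_def torus_proj_def cong_def prod_eq_iff)
    then show ?thesis using L(2) by blast
  qed
  have "x \<in> torus_proj n ` L" "y \<in> torus_proj n ` L" "p \<in> torus_proj n ` L"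
    using proj[of x 0] proj[of y s] proj[of p t] assms by auto
  then show ?thesis
    unfolding torus_collinear_def torus_line_def using L(1) assms(1-3) by blast
qed

text \<open>Along the direction \<open>(d1, d2)\<close>, \<open>p\<close> is reached exactly, but
  \<open>y\<close> only modulo \<open>3 * q\<close>: after \<plusminus>q steps the error is q times
  a multiple of 3.\<close>

lemma torus_collinear_third:
  fixes q :: nat
  assumes "x \<in> torus (3 * q)" "y \<in> torus (3 * q)" "p \<in> torus (3 * q)" "(d1, d2) \<noteq> (0, 0)"
    and y: "fst y = fst x + int q * w1" "snd y = snd x + int q * w2"
    and p: "fst p = fst x + t * d1" "snd p = snd x + t * d2"
    and w: "3 dvd d1 - w1 \<and> 3 dvd d2 - w2 \<or> 3 dvd d1 + w1 \<and> 3 dvd d2 + w2"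
  shows "torus_collinear (3 * q) {x, y, p}"
proof -
  have mult: "int (3 * q) dvd int q * z" if "3 dvd z" for z
    using mult_dvd_mono[OF dvd_refl[of "int q"] that] by (simp add: mult.commute)
  obtain s where s: "[fst y = fst x + s * d1] (mod int (3 * q))"
      "[snd y = snd x + s * d2] (mod int (3 * q))"
  proof (cases "3 dvd d1 - w1 \<and> 3 dvd d2 - w2")
    case True
    then have "3 dvd w1 - d1" "3 dvd w2 - d2" by presburger+
    from this[THEN mult] show thesis
      by (intro that[of "int q"]) (simp_all add: y cong_iff_dvd_diff algebra_simps)
  next
    case False
    then have "3 dvd w1 + d1" "3 dvd w2 + d2" using w by (auto simp: add.commute)
    from this[THEN mult] show thesis
      by (intro that[of "- int q"]) (simp_all add: y cong_iff_dvd_diff algebra_simps)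
  qed
  show ?thesis
    using torus_collinearI[of x "3 * q" y p "(d1, d2)" s t] assms(1-4) s p by simp
qed

text \<open>The power of \<open>r\<close> to remove is the one in \<open>gcd u v\<close>. What
  remains is a pair of coprime numbers times a factor prime to \<open>r\<close>, so \<open>r\<close>
  cannot divide both entries.\<close>

lemma prime_power_decompose_pair:
  fixes r u v :: int
  assumes "prime r" "(u, v) \<noteq> (0, 0)"
  obtains j d1 d2 where "u = r ^ j * d1" "v = r ^ j * d2" "\<not> (r dvd d1 \<and> r dvd d2)"
proof -
  have "gcd u v \<noteq> 0" "\<not> is_unit r" using assms by auto
  then obtain g where g: "gcd u v = r ^ multiplicity r (gcd u v) * g" "\<not> r dvd g"
    using multiplicity_decompose' by blast
  obtain a b where ab: "u = a * gcd u v" "v = b * gcd u v" "coprime a b"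
    using gcd_coprime_exists \<open>gcd u v \<noteq> 0\<close> by blast
  have "\<not> (r dvd g * a \<and> r dvd g * b)"
    using assms(1) g(2) ab(3)
    by (metis coprime_common_divisor not_prime_unit prime_dvd_mult_iff)
  moreover have "u = r ^ multiplicity r (gcd u v) * (g * a)" "v = r ^ multiplicity r (gcd u v) * (g * b)"
    using ab g(1) by (metis mult.assoc mult.commute)+
  ultimately show thesis using that by blast
qed

lemma dominating_set_corners:
  assumes "q > 0"
  shows "dominating_set (3 * q) ({0, int q} \<times> {0, int q})" (is "dominating_set _ ?S")
proof -
  have sub: "?S \<subseteq> torus (3 * q)" using assms by (auto simp: torus_def)
  have "dominated (3 * q) ?S p" if p: "p \<in> torus (3 * q)" for p
  proof (cases "p = (0, 0)")
    case True
    then show ?thesis by (simp add: dominated_def)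
  next
    case False
    \<comment> \<open>Here \<open>(e1, e2)\<close> is the direction from \<open>x\<close> to
      \<open>p\<close>, and \<open>(w1, w2)\<close> is y - x in units of q. As
      \<open>(w1, w2)\<close> is nonzero modulo 3, \<open>(e1, e2)\<close> is nonzero and
      \<open>x\<close>, \<open>y\<close> are distinct.\<close>
    have seen: ?thesis
      if "x \<in> ?S" "y \<in> ?S" "fst y = fst x + int q * w1" "snd y = snd x + int q * w2"
        "fst p = fst x + t * e1" "snd p = snd x + t * e2"
        "3 dvd e1 - w1 \<and> 3 dvd e2 - w2 \<or> 3 dvd e1 + w1 \<and> 3 dvd e2 + w2"
        "\<not> (3 dvd w1 \<and> 3 dvd w2)" for x y w1 w2 t e1 e2
    proof -
      have "(e1, e2) \<noteq> (0, 0)" using that(7,8) by auto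
      moreover have "x \<in> torus (3 * q)" "y \<in> torus (3 * q)" using that(1,2) sub by blast+
      ultimately have "torus_collinear (3 * q) {x, y, p}"
        using torus_collinear_third p that(3-7) by blast
      moreover have "x \<noteq> y" using that(3,4,8) assms by auto
      ultimately show ?thesis
        unfolding dominated_def using that(1,2) by blast
    qed
    obtain j d1 d2 where d: "fst p = 3 ^ j * d1" "snd p = 3 ^ j * d2" "\<not> (3 dvd d1 \<and> 3 dvd d2)"
      using prime_power_decompose_pair[of 3 "fst p" "snd p"] False by (auto simp: prod_eq_iff)
    have "int q \<noteq> 0" "\<not> is_unit (3 :: int)" using assms by simp_all
    then obtain k m where m: "int q = 3 ^ k * m" "\<not> 3 dvd m"
      using multiplicity_decompose' by blast
    \<comment> \<open>Up to sign there are four nonzero directions modulo 3.\<close>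
    have "3 dvd d2 \<or> 3 dvd d1 \<or> 3 dvd d1 - d2 \<or> 3 dvd d1 + d2" by presburger
    then consider (horizontal) "3 dvd d2" | (vertical) "3 dvd d1" | (diagonal) "3 dvd d1 - d2"
      | (antidiagonal) "3 dvd d1 + d2" "\<not> 3 dvd d1" by blast
    then show ?thesis
    proof cases
      case horizontal
      then have "3 dvd d1 - 1 \<and> 3 dvd d2 - 0 \<or> 3 dvd d1 + 1 \<and> 3 dvd d2 + 0"
        using d(3) by presburger
      then show ?thesis
        using d by (intro seen[of "(0, 0)" "(int q, 0)" 1 0 "3 ^ j" d1 d2]) auto
    next
      case vertical
      then have "3 dvd d1 - 0 \<and> 3 dvd d2 - 1 \<or> 3 dvd d1 + 0 \<and> 3 dvd d2 + 1"
        using d(3) by presburger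
      then show ?thesis
        using d by (intro seen[of "(0, 0)" "(0, int q)" 0 1 "3 ^ j" d1 d2]) auto
    next
      case diagonal
      then have "3 dvd d1 - 1 \<and> 3 dvd d2 - 1 \<or> 3 dvd d1 + 1 \<and> 3 dvd d2 + 1"
        using d(3) by presburger
      then show ?thesis
        using d by (intro seen[of "(0, 0)" "(int q, int q)" 1 1 "3 ^ j" d1 d2]) auto
    next
      case antidiagonal
      consider "j < k" | "k < j" | "j = k" by linarith
      then show ?thesis
      proof cases
        case 1
        then obtain i where "k = j + Suc i" using less_iff_Suc_add by auto
        then have q: "int q = 3 ^ j * (3 * (3 ^ i * m))" using m(1) by (simp add: power_add)
        \<comment> \<open>In units of \<open>3 ^ j\<close>, q is divisible by 3, so moving the
          viewpoint to \<open>(int q, 0)\<close> keeps the direction \<plusminus>(-1, 1), which now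
          points to \<open>(0, int q)\<close>.\<close>
        define e where "e = d1 - 3 * (3 ^ i * m)"
        have "3 dvd e - d1" by (simp add: e_def)
        then have "3 dvd e - (- 1) \<and> 3 dvd d2 - 1 \<or> 3 dvd e + (- 1) \<and> 3 dvd d2 + 1"
          using antidiagonal by presburger
        moreover have "fst p = int q + 3 ^ j * e" using d(1) q by (simp add: e_def algebra_simps)
        ultimately show ?thesis
          using d(2) by (intro seen[of "(int q, 0)" "(0, int q)" "- 1" 1 "3 ^ j" e d2]) auto
      next
        case 2
        then obtain i where "j = k + Suc i" using less_iff_Suc_add by auto
        then have p': "fst p = 3 ^ k * (3 * (3 ^ i * d1))" "snd p = 3 ^ k * (3 * (3 ^ i * d2))"
          using d(1,2) by (simp_all add: power_add)
        \<comment> \<open>In units of \<open>3 ^ k\<close>, \<open>p\<close> is congruent to the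
          origin modulo 3, so \<open>(int q, 0)\<close> sees both in the same horizontal
          direction.\<close>
        define e where "e = 3 * (3 ^ i * d1) - m"
        have "3 dvd e + m" by (simp add: e_def)
        then have "3 dvd e - (- 1) \<or> 3 dvd e + (- 1)" using m(2) by presburger
        moreover have "fst p = int q + 3 ^ k * e" using p' m(1) by (simp add: e_def algebra_simps)
        ultimately show ?thesis
          using p'(2)
          by (intro seen[of "(int q, 0)" "(0, 0)" "- 1" 0 "3 ^ k" e "3 * (3 ^ i * d2)"]) auto
      next
        case 3
        show ?thesis
        proof (cases "3 dvd d1 - m")
          case True
          \<comment> \<open>From \<open>(int q, 0)\<close> the first coordinate of the direction
            vanishes modulo 3.\<close>
          then have "3 dvd (d1 - m) - 0 \<and> 3 dvd d2 - 1 \<or> 3 dvd (d1 - m) + 0 \<and> 3 dvd d2 + 1"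
            using antidiagonal by presburger
          moreover have "fst p = int q + 3 ^ j * (d1 - m)"
            using d(1) m(1) 3 by (simp add: algebra_simps)
          ultimately show ?thesis
            using d(2)
            by (intro seen[of "(int q, 0)" "(int q, int q)" 0 1 "3 ^ j" "d1 - m" d2]) auto
        next
          case False
          \<comment> \<open>Both \<open>d1\<close> and \<open>m\<close> are units modulo 3, so d1 =
            -m and hence d2 = -d1 = m there: the direction from \<open>(0, int q)\<close> is
            horizontal.\<close>
          then have "3 dvd d1 - 1 \<and> 3 dvd (d2 - m) - 0 \<or> 3 dvd d1 + 1 \<and> 3 dvd (d2 - m) + 0"
            using antidiagonal m(2) by presburger
          moreover have "snd p = int q + 3 ^ j * (d2 - m)"
            using d(2) m(1) 3 by (simp add: algebra_simps)
          ultimately show ?thesis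
            using d(1)
            by (intro seen[of "(0, int q)" "(int q, int q)" 1 0 "3 ^ j" d1 "d2 - m"]) auto
        qed
      qed
    qed
  qed
  then show ?thesis using sub by (simp add: dominating_set_def)
qed

theorem proposition1:
  fixes n q :: nat
  assumes "q > 0" and "n = 3 * q"
  shows "domination_number n \<le> 4"
proof -
  let ?S = "{0, int q} \<times> {0, int q}"
  have "domination_number n \<le> card ?S"
    unfolding domination_number_def
    using dominating_set_corners[OF assms(1)] assms(2) by (intro Least_le) blast
  also have "card ?S = 4" using assms(1) by (simp add: card_cartesian_product)
  finally show ?thesis .
qed

end
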